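(* (1) The generating function for the number of up-down permutations of length $n$ that contain $1\mbox{-}3\mbox{-}2$ exactly once is $$\frac{x\bigl(1-\sqrt{1-4x^2}\bigr)}{1-4x^2+\sqrt{1-4x^2}};$$ equivalently, for every $n\ge0$ this number is $\binom{n-1}{(n-3)/2}$. (2) The generating function for the number of up-up permutations of length $n$ that contain $1\mbox{-}3\mbox{-}2$ exactly once is $$\frac{x^2-1}{x^2}+\frac{1-3x^2}{x^2\sqrt{1-4x^2}};$$ equivalently, for every $n\ge0$ this number is $2\binom{n-1}{(n-4)/2}$. (3) The generating function for the number of down-down permutations of length $n$ that contain $1\mbox{-}3\mbox{-}2$ exactly once is $$\frac{x^2-1}{x^2}+\frac{1-3x^2}{x^2\sqrt{1-4x^2}};$$ equivalently, for every $n\ge0$ this number is $2\binom{n-1}{(n-4)/2}$. (4) The generating function for the number of down-up permutations of length $n$ that contain $1\mbox{-}3\mbox{-}2$ exactly once is $$\frac{2x^4+4x^2-3}{2x^3}+\frac{3-10x^2}{2x^3\sqrt{1-4x^2}};$$ equivalently, for every $n\ge2$ this number is $\frac32\binom{n+3}{(n+3)/2}-5\binom{n+1}{(n+1)/2}$. Here $\binom ab$ is taken to be $0$ whenever $a<b$, $b<0$, or $b$ is not an integer.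
   Context: A permutation of length $n$ is a word $\pi_1\cdots\pi_n$ containing each of $1,\dots,n$ exactly once. An occurrence of the classical pattern $1\mbox{-}3\mbox{-}2$ in $\pi$ is a triple of indices $i<j<l$ with $\pi_i<\pi_l<\pi_j$; $\pi$ contains $1\mbox{-}3\mbox{-}2$ exactly once if there is exactly one such triple. For $n\ge2$: up-down permutations satisfy $\pi_1<\pi_2>\pi_3<\cdots$ with $n$ odd; up-up ones satisfy $\pi_1<\pi_2>\pi_3<\cdots$ with $n$ even; down-up ones satisfy $\pi_1>\pi_2<\pi_3>\cdots$ with $n$ odd; down-down ones satisfy $\pi_1>\pi_2<\pi_3>\cdots$ with $n$ even. For $n=0,1$ these classes are empty. Generating functions are $\sum_{n\ge0}c(n)x^n$ for the relevant count $c(n)$. *)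

theory Defs
  imports
    Complex_Main
    "HOL-Computational_Algebra.Formal_Laurent_Series"
    "HOL-Combinatorics.Multiset_Permutations"
begin

text \<open>
  A permutation of length \<open>n\<close> is a list in \<open>permutations_of_set {1..n}\<close>. List positions start
  at 0, so the first comparison (between the first two entries) is the one at an even position.
\<close>

definition occurrences_132 :: "nat list \<Rightarrow> (nat \<times> nat \<times> nat) set" where
  "occurrences_132 p =
     {(i, j, l). i < j \<and> j < l \<and> l < length p \<and> p ! i < p ! l \<and> p ! l < p ! j}"

definition contains_132_once :: "nat list \<Rightarrow> bool" where
  "contains_132_once p \<longleftrightarrow> card (occurrences_132 p) = 1"

definition alternating_up :: "nat list \<Rightarrow> bool" where
  "alternating_up p \<longleftrightarrow>
     (\<forall>i. Suc i < length p \<longrightarrow> (if even i then p ! i < p ! Suc i else p ! i > p ! Suc i))"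

definition alternating_down :: "nat list \<Rightarrow> bool" where
  "alternating_down p \<longleftrightarrow>
     (\<forall>i. Suc i < length p \<longrightarrow> (if even i then p ! i > p ! Suc i else p ! i < p ! Suc i))"

definition up_down_perms :: "nat \<Rightarrow> nat list set" where
  "up_down_perms n = {p \<in> permutations_of_set {1..n}. n \<ge> 2 \<and> odd n \<and> alternating_up p}"

definition up_up_perms :: "nat \<Rightarrow> nat list set" where
  "up_up_perms n = {p \<in> permutations_of_set {1..n}. n \<ge> 2 \<and> even n \<and> alternating_up p}"

definition down_up_perms :: "nat \<Rightarrow> nat list set" where
  "down_up_perms n = {p \<in> permutations_of_set {1..n}. n \<ge> 2 \<and> odd n \<and> alternating_down p}"

definition down_down_perms :: "nat \<Rightarrow> nat list set" where
  "down_down_perms n = {p \<in> permutations_of_set {1..n}. n \<ge> 2 \<and> even n \<and> alternating_down p}"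

definition count_132_once :: "(nat \<Rightarrow> nat list set) \<Rightarrow> nat \<Rightarrow> nat" where
  "count_132_once C n = card {p \<in> C n. contains_132_once p}"

text \<open>
  Generating functions live in the field of formal Laurent series, since some of the
  closed forms have individual summands with a pole at 0.
\<close>

definition gen_fun :: "(nat \<Rightarrow> nat) \<Rightarrow> real fls" where
  "gen_fun c = fps_to_fls (Abs_fps (\<lambda>n. real (c n)))"

definition sqrt_1_4x2 :: "real fls" where
  "sqrt_1_4x2 = fps_to_fls (fps_radical root 2 (1 - 4 * fps_X ^ 2))"

lemma sqrt_1_4x2_square: "sqrt_1_4x2 ^ 2 = 1 - 4 * fls_X ^ 2"
proof -
  let ?a = "1 - 4 * fps_X ^ 2 :: real fps"
  have a0: "?a $ 0 = 1"
    by (simp add: numeral_fps_const)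
  then have "(root (Suc 1) (?a $ 0)) ^ Suc 1 = ?a $ 0"
    by simp
  then have "fps_radical root (Suc 1) ?a ^ Suc 1 = ?a"
    using power_radical[of ?a root 1] a0 by auto
  then have "fps_radical root 2 ?a ^ 2 = ?a"
    by (simp add: numeral_2_eq_2)
  then have "sqrt_1_4x2 ^ 2 = fps_to_fls ?a"
    by (metis sqrt_1_4x2_def fps_to_fls_power)
  then show ?thesis
    by (simp add: fls_times_fps_to_fls fps_to_fls_power)
qed

lemma sqrt_1_4x2_nth_0: "fls_nth sqrt_1_4x2 0 = 1"
  by (simp add: sqrt_1_4x2_def numeral_fps_const)

definition binom0 :: "int \<Rightarrow> real \<Rightarrow> nat" where
  "binom0 a b = (if of_int a < b \<or> b < 0 \<or> b \<notin> \<int> then 0 else nat a choose nat \<lfloor>b\<rfloor>)"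

end

theory Submission
  imports Defs
begin

text \<open>
  Split a permutation at its maximum, \<open>p = L @ n # R\<close>. If \<open>p\<close> contains 132 at most once, then either
  every entry of \<open>L\<close> exceeds every entry of \<open>R\<close>, and all occurrences lie inside \<open>L\<close> or inside \<open>R\<close>;
  or the only occurrence uses \<open>n\<close>, in which case \<open>L = L' @ [k]\<close>, the entries of \<open>R\<close> are those below \<open>k\<close>
  together with \<open>k + 1\<close>, and \<open>L'\<close> and \<open>R\<close> avoid 132. Alternation of \<open>p\<close> only constrains the parity
  of \<open>length L\<close> and forces \<open>R\<close> to start with an ascent. This gives polynomial equations for the generating
  functions, graded by the direction of the first step and the parity of the length, which are solved
  in terms of \<open>sqrt (1 - 4 * x^2)\<close>, the inverse of the generating function of the central binomial
  coefficients.
\<close>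

subsection \<open>Alternation and occurrences of 132\<close>

text \<open>\<open>s\<close> is the direction of the first step. One recursion for both directions
  lets a single induction, in which \<open>s\<close> flips, serve all four classes.\<close>

fun alternating :: "bool \<Rightarrow> nat list \<Rightarrow> bool" where
  "alternating s (x # y # zs) \<longleftrightarrow> (if s then x < y else y < x) \<and> alternating (\<not> s) (y # zs)"
| "alternating s _ \<longleftrightarrow> True"

lemma alternating_up_Cons: "alternating_up (x # y # zs) \<longleftrightarrow> x < y \<and> alternating_down (y # zs)"
proof
  assume *: "alternating_up (x # y # zs)"
  show "x < y \<and> alternating_down (y # zs)"
    unfolding alternating_down_def
  proof (intro conjI allI impI)
    show "x < y" using *[unfolded alternating_up_def, rule_format, of 0] by simp
  next
    fix i assume "Suc i < length (y # zs)"
    then show "if even i then (y # zs) ! i > (y # zs) ! Suc i else (y # zs) ! i < (y # zs) ! Suc i"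
      using *[unfolded alternating_up_def, rule_format, of "Suc i"] by (simp split: if_splits)
  qed
next
  assume *: "x < y \<and> alternating_down (y # zs)"
  show "alternating_up (x # y # zs)"
    unfolding alternating_up_def
  proof (intro allI impI)
    fix i assume "Suc i < length (x # y # zs)"
    then show "if even i then (x # y # zs) ! i < (x # y # zs) ! Suc i
        else (x # y # zs) ! i > (x # y # zs) ! Suc i"
      using * unfolding alternating_down_def by (cases i) auto
  qed
qed

lemma alternating_down_Cons: "alternating_down (x # y # zs) \<longleftrightarrow> y < x \<and> alternating_up (y # zs)"
proof
  assume *: "alternating_down (x # y # zs)"
  show "y < x \<and> alternating_up (y # zs)"
    unfolding alternating_up_def
  proof (intro conjI allI impI)
    show "y < x" using *[unfolded alternating_down_def, rule_format, of 0] by simp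
  next
    fix i assume "Suc i < length (y # zs)"
    then show "if even i then (y # zs) ! i < (y # zs) ! Suc i else (y # zs) ! i > (y # zs) ! Suc i"
      using *[unfolded alternating_down_def, rule_format, of "Suc i"] by (simp split: if_splits)
  qed
next
  assume *: "y < x \<and> alternating_up (y # zs)"
  show "alternating_down (x # y # zs)"
    unfolding alternating_down_def
  proof (intro allI impI)
    fix i assume "Suc i < length (x # y # zs)"
    then show "if even i then (x # y # zs) ! i > (x # y # zs) ! Suc i
        else (x # y # zs) ! i < (x # y # zs) ! Suc i"
      using * unfolding alternating_up_def by (cases i) auto
  qed
qed

lemma alternating_iff: "alternating s p \<longleftrightarrow> (if s then alternating_up p else alternating_down p)"
proof (induction s p rule: alternating.induct)
  case (1 s x y zs)
  then show ?case by (simp add: alternating_up_Cons alternating_down_Cons)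
qed (simp_all add: alternating_up_def alternating_down_def)

text \<open>A maximum is a peak. The step into it, at position \<open>length L - 1\<close>, must be
  an ascent, which fixes the parity of \<open>length L\<close>; the step out of it is a descent, so
  \<open>R\<close> starts with an ascent. If only \<open>L\<close> is empty, the first step is a
  descent, and the parity condition says just that.\<close>

lemma alternating_glue_max:
  assumes "\<forall>x\<in>set L \<union> set R. x < m"
  shows "alternating s (L @ m # R) \<longleftrightarrow>
    alternating s L \<and> alternating True R \<and> (L = [] \<and> R = [] \<or> even (length L) \<noteq> s)"
  using assms
proof (induction s L rule: alternating.induct)
  case ("2_1" s)
  then show ?case by (cases R) auto
next
  case ("2_2" s v)
  then show ?case by (cases R) auto
qed auto

text \<open>The step into \<open>k\<close> is a descent. This is needed for the entry that ends the
  left part in the exceptional case.\<close>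

lemma alternating_snoc_min:
  assumes "\<forall>x\<in>set L. k < x"
  shows "alternating s (L @ [k]) \<longleftrightarrow> alternating s L \<and> (L = [] \<or> even (length L) = s)"
  using assms by (induction s L rule: alternating.induct) auto

lemma alternating_map:
  assumes "\<forall>x\<in>set p. \<forall>y\<in>set p. f x < f y \<longleftrightarrow> x < y"
  shows "alternating s (map f p) = alternating s p"
  using assms by (induction s p rule: alternating.induct) auto

section \<open>Counting occurrences of 132 by recursion on lists\<close>

primrec count_descents_above :: "nat \<Rightarrow> nat list \<Rightarrow> nat" where
  "count_descents_above x [] = 0"
| "count_descents_above x (y # ys) =
     length (filter (\<lambda>z. x < z \<and> z < y) ys) + count_descents_above x ys"

text \<open>\<open>count_descents_above x\<close> counts the occurrences of 132 in which an entry
  \<open>x\<close> in front of the list is the 1; \<open>count_ascents_across z\<close> counts those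
  in which an entry \<open>z\<close> behind the list is the 2.\<close>

primrec count_ascents_across :: "nat \<Rightarrow> nat list \<Rightarrow> nat" where
  "count_ascents_across z [] = 0"
| "count_ascents_across z (x # xs) =
     (if x < z then length (filter (\<lambda>y. z < y) xs) else 0) + count_ascents_across z xs"

primrec count_132 :: "nat list \<Rightarrow> nat" where
  "count_132 [] = 0"
| "count_132 (x # xs) = count_descents_above x xs + count_132 xs"

lemma card_descents_above:
  "finite {(j, l). j < l \<and> l < length xs \<and> x < xs ! l \<and> xs ! l < xs ! j} \<and>
   card {(j, l). j < l \<and> l < length xs \<and> x < xs ! l \<and> xs ! l < xs ! j} = count_descents_above x xs"
proof (induction xs)
  case (Cons y ys)
  let ?D = "\<lambda>xs. {(j, l). j < l \<and> l < length xs \<and> x < xs ! l \<and> xs ! l < xs ! j}"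
  let ?A = "{l. l < length ys \<and> x < ys ! l \<and> ys ! l < y}"
  have eq: "?D (y # ys) = (\<lambda>l. (0, Suc l)) ` ?A \<union> (\<lambda>(j, l). (Suc j, Suc l)) ` ?D ys"
  proof (intro set_eqI, clarify)
    fix j l
    show "(j, l) \<in> ?D (y # ys) \<longleftrightarrow>
        (j, l) \<in> (\<lambda>l. (0, Suc l)) ` ?A \<union> (\<lambda>(j, l). (Suc j, Suc l)) ` ?D ys"
      by (cases j; cases l) (auto simp: image_iff)
  qed
  have "card ((\<lambda>l. (0::nat, Suc l)) ` ?A) = length (filter (\<lambda>z. x < z \<and> z < y) ys)"
    by (subst card_image) (auto simp: inj_on_def length_filter_conv_card)
  moreover have "card ((\<lambda>(j, l). (Suc j, Suc l)) ` ?D ys) = count_descents_above x ys"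
    using Cons by (subst card_image) (auto simp: inj_on_def)
  ultimately show ?case
    unfolding eq using Cons by (subst card_Un_disjoint) auto
qed simp

text \<open>Sorting the triples by whether their first index is 0 reproduces the recursion of
  \<open>count_132\<close>.\<close>

lemma card_occurrences_132: "finite (occurrences_132 p) \<and> card (occurrences_132 p) = count_132 p"
proof (induction p)
  case (Cons x xs)
  let ?D = "{(j, l). j < l \<and> l < length xs \<and> x < xs ! l \<and> xs ! l < xs ! j}"
  have eq: "occurrences_132 (x # xs) = (\<lambda>(j, l). (0, Suc j, Suc l)) ` ?D
      \<union> (\<lambda>(i, j, l). (Suc i, Suc j, Suc l)) ` occurrences_132 xs"
  proof (intro set_eqI, clarify)
    fix i j l
    show "(i, j, l) \<in> occurrences_132 (x # xs) \<longleftrightarrow> (i, j, l) \<in> (\<lambda>(j, l). (0, Suc j, Suc l)) ` ?D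
      \<union> (\<lambda>(i, j, l). (Suc i, Suc j, Suc l)) ` occurrences_132 xs"
      unfolding occurrences_132_def by (cases i; cases j; cases l) (auto simp: image_iff)
  qed
  have "card ((\<lambda>(j, l). (0::nat, Suc j, Suc l)) ` ?D) = count_descents_above x xs"
    using card_descents_above[of xs x] by (subst card_image) (auto simp: inj_on_def)
  moreover have "card ((\<lambda>(i, j, l). (Suc i, Suc j, Suc l)) ` occurrences_132 xs) = count_132 xs"
    using Cons by (subst card_image) (auto simp: inj_on_def)
  ultimately show ?case
    unfolding eq using Cons card_descents_above[of xs x] by (subst card_Un_disjoint) auto
qed (simp add: occurrences_132_def case_prod_unfold)

lemma count_descents_above_append:
  "count_descents_above x (L @ M) = count_descents_above x L + count_descents_above x M +
     (\<Sum>z\<leftarrow>M. if x < z then length (filter (\<lambda>y. z < y) L) else 0)"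
proof (induction L)
  case (Cons y L)
  have "length (filter (\<lambda>z. x < z \<and> z < y) M) + (\<Sum>z\<leftarrow>M. if x < z then length (filter (\<lambda>y. z < y) L) else 0)
      = (\<Sum>z\<leftarrow>M. if x < z then length (filter (\<lambda>y. z < y) (y # L)) else 0)"
    by (induction M) auto
  with Cons show ?case by simp
qed (simp cong: if_cong)

text \<open>An occurrence lies in \<open>L\<close>, lies in \<open>M\<close>, has its 1 in
  \<open>L\<close> and 32 in \<open>M\<close>, or has its 13 in \<open>L\<close> and 2 in
  \<open>M\<close>.\<close>

lemma count_132_append:
  "count_132 (L @ M) = count_132 L + count_132 M + (\<Sum>x\<leftarrow>L. count_descents_above x M) +
     (\<Sum>z\<leftarrow>M. count_ascents_across z L)"
  by (induction L) (simp_all add: count_descents_above_append sum_list_addf)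

section \<open>Occurrences of 132 around a maximum\<close>

lemma count_ascents_across_eq_0: "\<forall>x\<in>set L. x \<le> z \<Longrightarrow> count_ascents_across z L = 0"
  by (induction L) (auto simp: filter_empty_conv not_less)

lemma count_ascents_across_eq_0': "\<forall>x\<in>set L. z \<le> x \<Longrightarrow> count_ascents_across z L = 0"
  by (induction L) auto

lemma count_descents_above_eq_0: "\<forall>z\<in>set R. z \<le> x \<Longrightarrow> count_descents_above x R = 0"
  by (induction R) (auto simp: filter_empty_conv not_less)

text \<open>The entry \<open>m\<close> can only be the 3 of an occurrence, so it contributes one
  occurrence for each entry of \<open>L\<close> that is below an entry of \<open>R\<close>.\<close>

lemma count_132_glue_max:
  assumes "\<forall>x\<in>set L \<union> set R. x < m"
  shows "count_132 (L @ m # R) = count_132 L + count_132 R +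
    (\<Sum>x\<leftarrow>L. length (filter (\<lambda>z. x < z) R)) +
    (\<Sum>x\<leftarrow>L. count_descents_above x R) + (\<Sum>z\<leftarrow>R. count_ascents_across z L)"
proof -
  have "filter (\<lambda>z. x < z \<and> z < m) R = filter (\<lambda>z. x < z) R" for x
    using assms by (intro filter_cong) auto
  moreover have "count_ascents_across m L = 0"
    using assms by (intro count_ascents_across_eq_0) (auto intro: less_imp_le)
  moreover have "count_descents_above m R = 0"
    using assms by (intro count_descents_above_eq_0) (auto intro: less_imp_le)
  ultimately show ?thesis
    by (simp add: count_132_append sum_list_addf)
qed

lemma count_132_map:
  assumes "\<forall>x\<in>set p. \<forall>y\<in>set p. f x < f y \<longleftrightarrow> x < y"
  shows "count_132 (map f p) = count_132 p"
proof -
  have *: "count_descents_above (f x) (map f xs) = count_descents_above x xs"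
    if "\<forall>u\<in>insert x (set xs). \<forall>v\<in>insert x (set xs). f u < f v \<longleftrightarrow> u < v" for x xs
    using that by (induction xs) (auto simp: filter_map o_def intro!: arg_cong[where f = length] filter_cong)
  show ?thesis
    using assms by (induction p) (auto simp: *)
qed

text \<open>Every occurrence that is not inside \<open>L\<close> or inside \<open>R\<close> needs an
  entry of \<open>L\<close> below an entry of \<open>R\<close>.\<close>

lemma count_132_glue_dominated:
  assumes "\<forall>x\<in>set L \<union> set R. x < m" and "\<forall>x\<in>set L. \<forall>z\<in>set R. z < x"
  shows "count_132 (L @ m # R) = count_132 L + count_132 R"
proof -
  have "(\<Sum>x\<leftarrow>L. length (filter (\<lambda>z. x < z) R)) = 0" "(\<Sum>x\<leftarrow>L. count_descents_above x R) = 0"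
    "(\<Sum>z\<leftarrow>R. count_ascents_across z L) = 0"
    using assms(2)
    by (auto simp: filter_empty_conv less_imp_le not_less
        intro!: count_descents_above_eq_0 count_ascents_across_eq_0')
  then show ?thesis
    using count_132_glue_max[OF assms(1)] by linarith
qed

text \<open>Entries \<open>x\<close> of \<open>L\<close> and \<open>z\<close> of \<open>R\<close>
  with \<open>x < z\<close> would form the occurrence \<open>x, m, z\<close>.\<close>

lemma count_132_glue_eq_0D:
  assumes "\<forall>x\<in>set L \<union> set R. x < m" and "count_132 (L @ m # R) = 0" and "set L \<inter> set R = {}"
  shows "\<forall>x\<in>set L. \<forall>z\<in>set R. z < x"
proof -
  have "(\<Sum>x\<leftarrow>L. length (filter (\<lambda>z. x < z) R)) = 0"
    using count_132_glue_max[OF assms(1)] assms(2) by linarith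
  then show ?thesis
    using assms(3) by (fastforce simp: filter_empty_conv)
qed

text \<open>The pair \<open>k\<close>, \<open>z\<close> is the only ascent from the left part to the
  right part, so \<open>k, m, z\<close> is the only occurrence besides those inside \<open>L\<close>
  and inside \<open>R\<close>.\<close>

lemma count_132_glue_exceptional:
  assumes lt: "\<forall>x\<in>set L \<union> set R. x < m" "k < m" and L: "\<forall>x\<in>set L. k < x \<and> (\<forall>z\<in>set R. z < x)"
    and z: "z \<in> set R" "k < z" "\<forall>w\<in>set R. w \<noteq> z \<longrightarrow> w < k" "distinct R"
  shows "count_132 ((L @ [k]) @ m # R) = Suc (count_132 L + count_132 R)"
proof -
  obtain R1 R2 where R: "R = R1 @ z # R2" using split_list[OF z(1)] by blast
  have R12: "filter (\<lambda>z. k < z) R1 = []" "filter (\<lambda>z. k < z) R2 = []"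
    using z unfolding R by (force simp: filter_empty_conv)+
  have "filter (\<lambda>z. k < z) R = [z]" using R12 z unfolding R by simp
  moreover have "(\<Sum>x\<leftarrow>L. length (filter (\<lambda>z. x < z) R)) = 0" 
    using L by (fastforce simp: filter_empty_conv)
  ultimately have 1: "(\<Sum>x\<leftarrow>L @ [k]. length (filter (\<lambda>z. x < z) R)) = 1" by simp
  \<comment> \<open>A 32 above \<open>k\<close> needs two different values above \<open>k\<close>,
    but only \<open>z\<close> is available.\<close>
  have "\<forall>x\<in>set ys. x \<le> z \<Longrightarrow> \<forall>x\<in>set ys. x \<noteq> z \<longrightarrow> x < k \<Longrightarrow> count_descents_above k ys = 0" for ys
    using \<open>k < z\<close> by (induction ys) (fastforce simp: filter_empty_conv not_less)+
  moreover have "\<forall>x\<in>set R. x \<le> z" using z by fastforce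
  ultimately have "count_descents_above k R = 0" using z by blast
  moreover have "(\<Sum>x\<leftarrow>L. count_descents_above x R) = 0"
    using L by (auto intro!: count_descents_above_eq_0 less_imp_le)
  ultimately have 2: "(\<Sum>x\<leftarrow>L @ [k]. count_descents_above x R) = 0" by simp
  \<comment> \<open>Only \<open>k\<close> can be the 1 here, and no entry follows it to be the
    3.\<close>
  have "count_ascents_across w (ys @ [k]) = 0" if "\<forall>x\<in>set ys. w < x" for ys w
    using that by (induction ys) auto
  then have 3: "(\<Sum>z\<leftarrow>R. count_ascents_across z (L @ [k])) = 0"
    using L by auto
  have 4: "count_132 (L @ [k]) = count_132 L"
    using L by (auto simp: count_132_append intro!: count_ascents_across_eq_0' less_imp_le)
  show ?thesis
    using count_132_glue_max[of "L @ [k]" R m] lt unfolding 1 2 3 4 by simp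
qed

text \<open>If \<open>k < z\<close> with \<open>k\<close> in \<open>L\<close> and \<open>z\<close>
  in \<open>R\<close>, then \<open>k, m, z\<close> is the only occurrence. Another ascent from
  \<open>L\<close> to \<open>R\<close> would give a second one, and so would an entry after
  \<open>k\<close> in \<open>L\<close>.\<close>

lemma count_132_glue_eq_1D:
  assumes lt: "\<forall>x\<in>set L \<union> set R. x < m" and one: "count_132 (L @ m # R) = 1"
    and dist: "set L \<inter> set R = {}" "distinct L" "distinct R"
    and ex: "\<not> (\<forall>x\<in>set L. \<forall>z\<in>set R. z < x)"
  obtains L' k z where "L = L' @ [k]" "\<forall>x\<in>set L'. k < x \<and> (\<forall>z\<in>set R. z < x)"
    "z \<in> set R" "k < z" "\<forall>w\<in>set R. w \<noteq> z \<longrightarrow> w < k"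
proof -
  let ?S = "\<lambda>L. \<Sum>x\<leftarrow>L. length (filter (\<lambda>z. x < z) R)"
  obtain k z where kz: "k \<in> set L" "z \<in> set R" "k < z"
    using ex dist(1) by (metis disjoint_iff not_less_iff_gr_or_eq)
  obtain L1 L2 where L: "L = L1 @ k # L2" using split_list[OF kz(1)] by blast
  obtain R1 R2 where R: "R = R1 @ z # R2" using split_list[OF kz(2)] by blast
  have len: "length (filter (\<lambda>z. k < z) R) = Suc (length (filter (\<lambda>z. k < z) R1) + length (filter (\<lambda>z. k < z) R2))"
    unfolding R using kz(3) by simp
  have SL: "?S L = ?S L1 + length (filter (\<lambda>z. k < z) R) + ?S L2" unfolding L by simp
  \<comment> \<open>The pair \<open>k\<close>, \<open>z\<close> already contributes 1 to
    \<open>?S L\<close>, so every other term of the count vanishes.\<close>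
  from one len SL have S12: "?S L1 = 0" "?S L2 = 0"
    and e: "length (filter (\<lambda>z. k < z) R1) = 0" "length (filter (\<lambda>z. k < z) R2) = 0"
    and asc: "(\<Sum>z\<leftarrow>R. count_ascents_across z L) = 0"
    unfolding count_132_glue_max[OF lt] by linarith+
  have dom: "\<forall>x\<in>set L1 \<union> set L2. \<forall>z\<in>set R. z < x"
    using S12 dist(1) unfolding L by (fastforce simp: filter_empty_conv)
  have "count_ascents_across z L = 0" using asc kz(2) by simp
  \<comment> \<open>An entry \<open>y > z\<close> after \<open>k\<close> would give the occurrence
    \<open>k, y, z\<close>. Since the entries of \<open>L2\<close> exceed all of \<open>R\<close>,
    this leaves \<open>L2\<close> empty.\<close>
  then have "filter (\<lambda>y. z < y) L2 = []"
    using kz(3) unfolding L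
    by (induction L1) auto
  then have L2: "L2 = []" using dom kz(2) by (cases L2) auto
  have w: "\<forall>w\<in>set R. w \<noteq> z \<longrightarrow> w < k"
    using e kz(1) dist(1) unfolding R by (fastforce simp: filter_empty_conv)
  show thesis
    by (rule that[of L1 k z]) (use L L2 dom kz w in fastforce)+
qed

subsection \<open>Splitting at the maximum\<close>

text \<open>The value set is arbitrary because \<open>L\<close> and \<open>R\<close> use different
  values; by \<open>card_alt_perms\<close> only its size matters.\<close>

definition alt_perms :: "nat \<Rightarrow> bool \<Rightarrow> nat set \<Rightarrow> nat list set" where
  "alt_perms c s A = {p \<in> permutations_of_set A. alternating s p \<and> count_132 p = c}"

text \<open>Values start at 0, so that the maximum in length \<open>Suc n\<close> is
  \<open>n\<close>.\<close>

definition num_alt :: "nat \<Rightarrow> bool \<Rightarrow> nat \<Rightarrow> nat" where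
  "num_alt c s n = card (alt_perms c s {..<n})"

lemma alt_perms_iff:
  "p \<in> alt_perms c s A \<longleftrightarrow> set p = A \<and> distinct p \<and> alternating s p \<and> count_132 p = c"
  by (auto simp: alt_perms_def permutations_of_set_def)

lemma finite_alt_perms [simp]: "finite (alt_perms c s A)"
  by (simp add: alt_perms_def)

text \<open>Relabelling by the increasing bijection from \<open>{..<card A}\<close> to
  \<open>A\<close> preserves all comparisons.\<close>

lemma card_alt_perms:
  assumes "finite A"
  shows "card (alt_perms c s A) = num_alt c s (card A)"
proof -
  obtain h where bij: "bij_betw h {..<card A} A" and mono: "strict_mono_on {..<card A} h"
    using ex_bij_betw_strict_mono_card[OF assms] .
  have inj: "inj_on h {..<card A}" and img: "h ` {..<card A} = A"
    using bij by (auto simp: bij_betw_def)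
  have iff: "\<forall>x\<in>set p. \<forall>y\<in>set p. h x < h y \<longleftrightarrow> x < y" if "p \<in> permutations_of_set {..<card A}" for p
    using that strict_mono_on_less[OF mono] by (auto simp: permutations_of_set_def)
  have "alt_perms c s A = map h ` alt_perms c s {..<card A}"
    using permutations_of_set_image_inj[OF inj] alternating_map[OF iff] count_132_map[OF iff]
    unfolding alt_perms_def img by auto
  moreover have "inj_on (map h) (alt_perms c s {..<card A})"
    using inj by (intro inj_on_mapI) (auto simp: alt_perms_iff inj_on_def)
  ultimately show ?thesis
    by (simp add: card_image num_alt_def)
qed

section \<open>The pairs of parts on either side of the maximum\<close>

definition glue_pairs :: "nat \<Rightarrow> bool \<Rightarrow> nat \<Rightarrow> nat \<Rightarrow> (nat list \<times> nat list) set" where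
  "glue_pairs c s n i = {(L, R). length L = i \<and> L @ n # R \<in> alt_perms c s {..<Suc n}}"

lemma num_alt_Suc_glue_pairs: "num_alt c s (Suc n) = (\<Sum>i\<le>n. card (glue_pairs c s n i))"
proof -
  let ?g = "\<lambda>(L, R). L @ n # R"
  have inj: "inj_on ?g (\<Union>i\<le>n. glue_pairs c s n i)"
    by (auto simp: inj_on_def glue_pairs_def alt_perms_iff append_Cons_eq_iff)
  have img: "alt_perms c s {..<Suc n} = ?g ` (\<Union>i\<le>n. glue_pairs c s n i)"
  proof (intro set_eqI iffI)
    fix p assume p: "p \<in> alt_perms c s {..<Suc n}"
    then have "n \<in> set p" by (auto simp: alt_perms_iff)
    then obtain L R where LR: "p = L @ n # R" using split_list by metis
    have "length p = Suc n"
      using p distinct_card[of p] by (simp add: alt_perms_iff)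
    then have "length L \<le> n" using LR by simp
    then have "(L, R) \<in> (\<Union>i\<le>n. glue_pairs c s n i)"
      using p unfolding LR glue_pairs_def by auto
    then show "p \<in> ?g ` (\<Union>i\<le>n. glue_pairs c s n i)"
      unfolding LR by force
  qed (auto simp: glue_pairs_def)
  have fin: "finite (\<Union>i\<le>n. glue_pairs c s n i)"
    using finite_imageD[OF _ inj] finite_alt_perms[of c s "{..<Suc n}"] unfolding img by blast
  have "num_alt c s (Suc n) = card (\<Union>i\<le>n. glue_pairs c s n i)"
    unfolding num_alt_def img by (rule card_image[OF inj])
  also have "\<dots> = (\<Sum>i\<le>n. card (glue_pairs c s n i))"
    using fin by (intro card_UN_disjoint) (auto simp: glue_pairs_def)
  finally show ?thesis .
qed

lemma down_closed_eq_lessThan: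
  fixes S :: "nat set"
  assumes "finite S" and "\<And>z w. z \<in> S \<Longrightarrow> w < z \<Longrightarrow> w \<in> S"
  shows "S = {..<card S}"
proof (cases "S = {}")
  case False
  then have "S = {..Max S}"
    using assms(2)[OF Max_in[OF assms(1) False]] Max_in[OF assms(1) False] Max_ge[OF assms(1)]
    by (auto simp: le_less)
  then have "S = {..<Suc (Max S)}"
    by (simp only: lessThan_Suc_atMost)
  then show ?thesis
    by (metis card_lessThan)
qed simp

lemma glue_in_alt_perms_iff:
  "L @ n # R \<in> alt_perms c s {..<Suc n} \<longleftrightarrow>
     distinct L \<and> distinct R \<and> set L \<inter> set R = {} \<and> set L \<union> set R = {..<n} \<and>
     alternating s L \<and> alternating True R \<and> (L = [] \<and> R = [] \<or> even (length L) \<noteq> s) \<and>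
     count_132 (L @ n # R) = c" (is "?l \<longleftrightarrow> ?r")
proof -
  have "set (L @ n # R) = {..<Suc n} \<and> distinct (L @ n # R) \<longleftrightarrow>
      distinct L \<and> distinct R \<and> set L \<inter> set R = {} \<and> set L \<union> set R = {..<n}" (is "?a \<longleftrightarrow> ?b")
  proof
    assume ?a
    then have "set L \<union> set R = {..<Suc n} - {n}" by auto
    with \<open>?a\<close> show ?b by (auto simp: lessThan_Suc)
  next
    assume b: ?b
    then have "n \<notin> set L" "n \<notin> set R" by auto
    with b show ?a by (auto simp: lessThan_Suc)
  qed
  moreover have "set L \<union> set R = {..<n} \<Longrightarrow> \<forall>x\<in>set L \<union> set R. x < n" by simp
  ultimately show ?thesis
    unfolding alt_perms_iff using alternating_glue_max[of L R n s] by blast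
qed

text \<open>Everything below an entry of \<open>R\<close> is again in \<open>R\<close>, so
  \<open>R\<close> holds the smallest values, and the length of \<open>L\<close> determines how
  many.\<close>

lemma dominated_split_sets:
  assumes "distinct L" "distinct R" "set L \<inter> set R = {}" "set L \<union> set R = {..<n}" "length L = i"
    and "\<forall>x\<in>set L. \<forall>z\<in>set R. z < x"
  shows "set R = {..<n - i}" "set L = {n - i..<n}"
proof -
  have "card (set L) + card (set R) = n"
    using assms card_Un_disjoint[of "set L" "set R"] by simp
  then have "card (set R) = n - i"
    using assms distinct_card by fastforce
  moreover have "set R = {..<card (set R)}"
  proof (rule down_closed_eq_lessThan)
    fix z w assume "z \<in> set R" "w < z"
    moreover from this have "w \<in> set L \<union> set R"
      using assms(4) by (metis UnCI less_trans lessThan_iff)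
    ultimately show "w \<in> set R" using assms(6) by force
  qed simp
  ultimately show R: "set R = {..<n - i}" by simp
  have "set L = {..<n} - set R" using assms(3,4) by blast
  then show "set L = {n - i..<n}" unfolding R by auto
qed

text \<open>From bottom to top the values are those of \<open>R\<close> without \<open>z\<close>,
  then \<open>k\<close>, then \<open>z\<close>, then those of \<open>L\<close>. The first three
  unions in this order are closed downwards, hence initial segments, and their sizes give
  \<open>k\<close> and \<open>z\<close>.\<close>

lemma exceptional_split_sets:
  assumes "set (L @ [k]) \<inter> set R = {}" "set (L @ [k]) \<union> set R = {..<n}"
    "length (L @ [k]) = i" "distinct (L @ [k])"
    and dom: "\<forall>x\<in>set L. k < x \<and> (\<forall>z\<in>set R. z < x)"
    and z: "z \<in> set R" "k < z" "\<forall>w\<in>set R. w \<noteq> z \<longrightarrow> w < k"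
  shows "i < n" "k = n - i - 1" "set R = insert (n - i) {..<n - i - 1}" "set L = {n - i + 1..<n}"
proof -
  have "card (set (L @ [k])) + card (set R) = n"
    using assms(1,2) card_Un_disjoint[of "set (L @ [k])" "set R"] by simp
  then have iR: "i + card (set R) = n"
    using assms(3,4) distinct_card by metis
  have "card (set R) > 0" using z(1) by (auto simp: card_gt_0_iff)
  then show "i < n" using iR by linarith
  have below: "w \<in> set L \<or> w = k \<or> w \<in> set R" if "w < y" "y \<in> set L \<or> y = k \<or> y \<in> set R" for w y
  proof -
    have "y < n" using that(2) assms(2) by auto
    then have "w \<in> {..<n}" using that by simp
    then show ?thesis unfolding assms(2)[symmetric] by auto
  qed
  have c1: "card (set R - {z}) = n - i - 1" using iR z(1) by simp
  have "set R - {z} = {..<card (set R - {z})}"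
  proof (rule down_closed_eq_lessThan)
    fix y w assume y: "y \<in> set R - {z}" "w < y"
    then have "w < k" using z(3) by (metis DiffD1 DiffD2 less_trans singletonI)
    then show "w \<in> set R - {z}" using below[of w y] y dom z by force
  qed simp
  then have Rz: "set R - {z} = {..<n - i - 1}" using c1 by simp
  have kn: "k \<notin> set R - {z}" using assms(1) by auto
  have "insert k (set R - {z}) = {..<card (insert k (set R - {z}))}"
  proof (rule down_closed_eq_lessThan)
    fix y w assume y: "y \<in> insert k (set R - {z})" "w < y"
    then have "w < k" using z(3) by (metis DiffD1 DiffD2 insertE less_trans singletonI)
    then show "w \<in> insert k (set R - {z})" using below[of w y] y dom z by force
  qed simp
  moreover have "card (insert k (set R - {z})) = Suc (n - i - 1)"
    using kn c1 by simp
  ultimately have 2: "insert k {..<n - i - 1} = {..<Suc (n - i - 1)}"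
    unfolding Rz by simp
  show k: "k = n - i - 1"
    using 2 kn unfolding Rz lessThan_Suc by (metis insert_ident lessThan_iff less_irrefl insert_iff)
  have zn: "z \<notin> {..<Suc (n - i - 1)}" using z(2) k by simp
  have "insert z {..<Suc (n - i - 1)} = {..<card (insert z {..<Suc (n - i - 1)})}"
  proof (rule down_closed_eq_lessThan)
    fix y w assume y: "y \<in> insert z {..<Suc (n - i - 1)}" "w < y"
    then have "y \<in> set R \<or> y = k" "w < y" using 2 Rz z(1) by auto
    moreover from this have "w \<in> set R \<or> w = k" using below[of w y] dom z by force
    ultimately show "w \<in> insert z {..<Suc (n - i - 1)}" using 2 Rz by blast
  qed simp
  then have "z = n - i"
    using zn \<open>i < n\<close> by (metis Suc_diff_Suc card_insert_disjoint card_lessThan diff_Suc_1 diff_diff_left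
      finite_lessThan insert_iff lessThan_iff less_Suc_eq plus_1_eq_Suc add.commute)
  then show R: "set R = insert (n - i) {..<n - i - 1}" using Rz z(1) by blast
  have "set L = {..<n} - set R - {k}" using assms(1,2,4) by auto
  moreover have "x \<in> {..<n} - insert (n - i) {..<n - i - 1} - {n - i - 1} \<longleftrightarrow> x \<in> {n - i + 1..<n}" for x
    using \<open>i < n\<close> by simp linarith
  ultimately show "set L = {n - i + 1..<n}" unfolding R k by blast
qed

text \<open>Domination forces the two value sets and makes the count additive, whence
  \<open>a + b = c\<close>. The disjunct \<open>n = 0\<close> is the case of two empty parts in
  \<open>alternating_glue_max\<close>.\<close>

lemma dominated_glue_pairs_iff:
  assumes "i \<le> n"
  shows "(L, R) \<in> glue_pairs c s n i \<and> (\<forall>x\<in>set L. \<forall>z\<in>set R. z < x) \<longleftrightarrow>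
    (n = 0 \<or> even i \<noteq> s) \<and> (\<exists>a b. a + b = c \<and> L \<in> alt_perms a s {n - i..<n} \<and> R \<in> alt_perms b True {..<n - i})"
    (is "?l \<longleftrightarrow> ?r")
proof
  assume l: ?l
  then have *: "distinct L" "distinct R" "set L \<inter> set R = {}" "set L \<union> set R = {..<n}" "length L = i"
     "alternating s L" "alternating True R" "L = [] \<and> R = [] \<or> even (length L) \<noteq> s"
     "count_132 (L @ n # R) = c" "\<forall>x\<in>set L. \<forall>z\<in>set R. z < x"
    by (auto simp: glue_pairs_def glue_in_alt_perms_iff)
  have "count_132 L + count_132 R = c"
    using count_132_glue_dominated[of L R n] * by auto
  then show ?r
    using * dominated_split_sets[OF *(1-5,10)] by (auto simp: alt_perms_iff)
next
  assume r: ?r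
  then obtain a b where ab: "a + b = c" "L \<in> alt_perms a s {n - i..<n}" "R \<in> alt_perms b True {..<n - i}"
    by blast
  then have sets: "set L = {n - i..<n}" "set R = {..<n - i}" "distinct L" by (auto simp: alt_perms_iff)
  then have len: "length L = i" using distinct_card[of L] assms by simp
  have dom: "\<forall>x\<in>set L. \<forall>z\<in>set R. z < x" unfolding sets by auto
  have lt: "\<forall>x\<in>set L \<union> set R. x < n" unfolding sets by auto
  have "L = [] \<and> R = [] \<or> even (length L) \<noteq> s" using r sets len by auto
  moreover have "set L \<union> set R = {..<n}" "set L \<inter> set R = {}" unfolding sets by auto
  ultimately show ?l
    using ab[unfolded alt_perms_iff] count_132_glue_dominated[OF lt dom] dom len
    by (simp add: glue_pairs_def glue_in_alt_perms_iff)
qed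

text \<open>Without any occurrence, domination holds automatically.\<close>

lemma glue_pairs_0:
  assumes "i \<le> n"
  shows "glue_pairs 0 s n i =
    (if n = 0 \<or> even i \<noteq> s then alt_perms 0 s {n - i..<n} \<times> alt_perms 0 True {..<n - i} else {})"
proof -
  have "\<forall>x\<in>set L. \<forall>z\<in>set R. z < x" if "(L, R) \<in> glue_pairs 0 s n i" for L R
    using that by (intro count_132_glue_eq_0D[of L R n]) (auto simp: glue_pairs_def glue_in_alt_perms_iff)
  then have "(L, R) \<in> glue_pairs 0 s n i \<longleftrightarrow> (n = 0 \<or> even i \<noteq> s) \<and>
      L \<in> alt_perms 0 s {n - i..<n} \<and> R \<in> alt_perms 0 True {..<n - i}" for L R
    using dominated_glue_pairs_iff[OF assms, of L R 0 s] by auto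
  then show ?thesis by auto
qed

text \<open>The only occurrence is \<open>n - i - 1, n, n - i\<close>, so \<open>L'\<close> and
  \<open>R\<close> avoid 132. They are otherwise free: since \<open>even i \<noteq> s\<close>, the
  step from \<open>L'\<close> down to \<open>n - i - 1\<close> has the right direction.\<close>

lemma exceptional_glue_pairs_iff:
  assumes "i \<le> n"
  shows "(L, R) \<in> glue_pairs 1 s n i \<and> \<not> (\<forall>x\<in>set L. \<forall>z\<in>set R. z < x) \<longleftrightarrow>
    even i \<noteq> s \<and> 0 < i \<and> i < n \<and> (\<exists>L'. L = L' @ [n - i - 1] \<and> L' \<in> alt_perms 0 s {n - i + 1..<n} \<and>
      R \<in> alt_perms 0 True (insert (n - i) {..<n - i - 1}))"
    (is "?l \<longleftrightarrow> ?r")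
proof
  assume l: ?l
  then have *: "distinct L" "distinct R" "set L \<inter> set R = {}" "set L \<union> set R = {..<n}" "length L = i"
     "alternating s L" "alternating True R" "L = [] \<and> R = [] \<or> even (length L) \<noteq> s"
     "count_132 (L @ n # R) = 1" "\<not> (\<forall>x\<in>set L. \<forall>z\<in>set R. z < x)"
    by (auto simp: glue_pairs_def glue_in_alt_perms_iff)
  have lt: "\<forall>x\<in>set L \<union> set R. x < n" using *(4) by auto
  obtain L' k z where **: "L = L' @ [k]" "\<forall>x\<in>set L'. k < x \<and> (\<forall>z\<in>set R. z < x)"
    "z \<in> set R" "k < z" "\<forall>w\<in>set R. w \<noteq> z \<longrightarrow> w < k"
    using count_132_glue_eq_1D[OF lt *(9,3,1,2,10)] by blast
  have "distinct L'" using *(1) **(1) by simp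
  note sets = exceptional_split_sets[OF *(3-5,1)[unfolded **(1)] **(2-5)]
  have "count_132 ((L' @ [k]) @ n # R) = Suc (count_132 L' + count_132 R)"
    using lt **(1) by (intro count_132_glue_exceptional[OF _ _ **(2-5) *(2)]) auto
  then have "count_132 L' = 0" "count_132 R = 0" using *(9) **(1) by auto
  moreover have "alternating s L'"
    using *(6) alternating_snoc_min[of L' k s] **(1,2) by simp
  moreover have "even i \<noteq> s" "0 < i" using *(5,8) **(1) by auto
  ultimately show ?r
    using sets *(2,7) **(1) \<open>distinct L'\<close> by (auto simp: alt_perms_iff)
next
  assume r: ?r
  define k where "k = n - i - 1"
  from r obtain L' where L: "L = L' @ [k]" and L': "L' \<in> alt_perms 0 s {n - i + 1..<n}"
    and R: "R \<in> alt_perms 0 True (insert (n - i) {..<n - i - 1})" and i: "even i \<noteq> s" "0 < i" "i < n"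
    unfolding k_def by blast
  have sets: "set L' = {n - i + 1..<n}" "set R = insert (n - i) {..<n - i - 1}" "distinct L'" "distinct R"
    using L' R by (auto simp: alt_perms_iff)
  have len: "length L' = i - 1" using distinct_card[OF sets(3)] sets(1) i by simp
  have dom: "\<forall>x\<in>set L'. k < x \<and> (\<forall>z\<in>set R. z < x)" using sets i unfolding k_def by auto
  have z: "n - i \<in> set R" "k < n - i" "\<forall>w\<in>set R. w \<noteq> n - i \<longrightarrow> w < k"
    using sets i unfolding k_def by auto
  have "count_132 (L @ n # R) = Suc (count_132 L' + count_132 R)"
    unfolding L using sets i by (intro count_132_glue_exceptional[OF _ _ dom z sets(4)]) (auto simp: k_def)
  then have "count_132 (L @ n # R) = 1" using L' R by (simp add: alt_perms_iff)
  moreover have "alternating s L"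
    using L' dom alternating_snoc_min[of L' k s] i len unfolding L by (auto simp: alt_perms_iff)
  moreover have "set L \<union> set R = {..<n}" "set L \<inter> set R = {}" "distinct L"
    unfolding L using sets i by (auto simp: k_def)
  moreover have "length L = i" using len i L by simp
  moreover have "\<not> (\<forall>x\<in>set L. \<forall>z\<in>set R. z < x)"
    using L z by (auto intro!: bexI[of _ "n - i"])
  ultimately show ?l
    using R[unfolded alt_perms_iff] i by (simp add: glue_pairs_def glue_in_alt_perms_iff)
qed

text \<open>Under domination the single occurrence is inside \<open>L\<close> or inside
  \<open>R\<close>; the remaining pairs are the exceptional ones.\<close>

lemma glue_pairs_1:
  assumes "i \<le> n"
  shows "glue_pairs 1 s n i =
    (if n = 0 \<or> even i \<noteq> s then alt_perms 1 s {n - i..<n} \<times> alt_perms 0 True {..<n - i} \<union>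
      alt_perms 0 s {n - i..<n} \<times> alt_perms 1 True {..<n - i} else {}) \<union>
    (if even i \<noteq> s \<and> 0 < i \<and> i < n then (\<lambda>(L, R). (L @ [n - i - 1], R)) `
      (alt_perms 0 s {n - i + 1..<n} \<times> alt_perms 0 True (insert (n - i) {..<n - i - 1})) else {})"
    (is "_ = ?A \<union> ?B")
proof -
  have "(L, R) \<in> ?A \<longleftrightarrow> (L, R) \<in> glue_pairs 1 s n i \<and> (\<forall>x\<in>set L. \<forall>z\<in>set R. z < x)" for L R
    unfolding dominated_glue_pairs_iff[OF assms] by (auto simp: add_is_1)
  moreover have "(L, R) \<in> ?B \<longleftrightarrow> (L, R) \<in> glue_pairs 1 s n i \<and> \<not> (\<forall>x\<in>set L. \<forall>z\<in>set R. z < x)" for L R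
    unfolding exceptional_glue_pairs_iff[OF assms] by (auto simp: image_iff)
  ultimately show ?thesis
    unfolding set_eq_iff split_paired_All by blast
qed

section \<open>Recurrences for the numbers of permutations\<close>

lemma num_alt_0_Suc:
  "num_alt 0 s (Suc n) =
    (\<Sum>i\<le>n. if n = 0 \<or> even i \<noteq> s then num_alt 0 s i * num_alt 0 True (n - i) else 0)"
  unfolding num_alt_Suc_glue_pairs
  by (intro sum.cong) (auto simp: glue_pairs_0 card_cartesian_product card_alt_perms)

lemma num_alt_1_Suc:
  "num_alt 1 s (Suc n) =
    (\<Sum>i\<le>n. (if n = 0 \<or> even i \<noteq> s then num_alt 1 s i * num_alt 0 True (n - i) +
        num_alt 0 s i * num_alt 1 True (n - i) else 0) +
      (if even i \<noteq> s \<and> 0 < i \<and> i < n then num_alt 0 s (i - 1) * num_alt 0 True (n - i) else 0))"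
  unfolding num_alt_Suc_glue_pairs
proof (intro sum.cong refl)
  fix i assume "i \<in> {..n}"
  then have i: "i \<le> n" by simp
  let ?P = "alt_perms 1 s {n - i..<n} \<times> alt_perms 0 True {..<n - i}"
  let ?Q = "alt_perms 0 s {n - i..<n} \<times> alt_perms 1 True {..<n - i}"
  let ?A = "if n = 0 \<or> even i \<noteq> s then ?P \<union> ?Q else {}"
  let ?T = "alt_perms 0 s {n - i + 1..<n} \<times> alt_perms 0 True (insert (n - i) {..<n - i - 1})"
  let ?B = "if even i \<noteq> s \<and> 0 < i \<and> i < n then (\<lambda>(L, R). (L @ [n - i - 1], R)) ` ?T else {}"
  have "card (?P \<union> ?Q) = num_alt 1 s i * num_alt 0 True (n - i) + num_alt 0 s i * num_alt 1 True (n - i)"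
    using i by (subst card_Un_disjoint) (auto simp: card_cartesian_product card_alt_perms alt_perms_iff)
  then have A: "card ?A = (if n = 0 \<or> even i \<noteq> s then num_alt 1 s i * num_alt 0 True (n - i) +
        num_alt 0 s i * num_alt 1 True (n - i) else 0)" by simp
  have "card ((\<lambda>(L, R). (L @ [n - i - 1], R)) ` ?T) = num_alt 0 s (i - 1) * num_alt 0 True (n - i)"
    if "i < n" "0 < i"
  proof -
    have "inj_on (\<lambda>(L, R). (L @ [n - i - 1], R)) ?T" by (auto simp: inj_on_def)
    moreover have "Suc (n - Suc i) = n - i" "n - Suc (n - i) = i - 1" using that by auto
    ultimately show ?thesis
      by (simp add: card_image card_cartesian_product card_alt_perms)
  qed
  then have B: "card ?B = (if even i \<noteq> s \<and> 0 < i \<and> i < n then num_alt 0 s (i - 1) * num_alt 0 True (n - i) else 0)"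
    by auto
  \<comment> \<open>An exceptional left part contains \<open>n - i - 1\<close>, whereas a dominating
    one has only values from \<open>n - i\<close> on.\<close>
  have "n - i - 1 < n - i" if "i < n" using that by simp
  then have "?A \<inter> ?B = {}"
    by (auto simp: alt_perms_iff)
  then have "card (glue_pairs 1 s n i) = card ?A + card ?B"
    unfolding glue_pairs_1[OF i] by (intro card_Un_disjoint) auto
  then show "card (glue_pairs 1 s n i) = (if n = 0 \<or> even i \<noteq> s then num_alt 1 s i * num_alt 0 True (n - i) +
        num_alt 0 s i * num_alt 1 True (n - i) else 0) +
      (if even i \<noteq> s \<and> 0 < i \<and> i < n then num_alt 0 s (i - 1) * num_alt 0 True (n - i) else 0)"
    unfolding A B .
qed

lemma num_alt_0: "num_alt c s 0 = (if c = 0 then 1 else 0)"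
proof -
  have "alt_perms c s {..<0} = (if c = 0 then {[]} else {})"
    by (auto simp: alt_perms_iff)
  then show ?thesis by (simp add: num_alt_def)
qed

lemma count_132_once_eq:
  "count_132_once up_down_perms n = (if odd n then num_alt 1 True n else 0)"
  "count_132_once up_up_perms n = (if even n then num_alt 1 True n else 0)"
  "count_132_once down_up_perms n = (if odd n then num_alt 1 False n else 0)"
  "count_132_once down_down_perms n = (if even n then num_alt 1 False n else 0)"
proof -
  \<comment> \<open>For lengths 0 and 1 the classes are empty by definition, and
    \<open>num_alt 1\<close> is 0 as well.\<close>
  have small: "num_alt 1 s n = 0" if "n < 2" for s
    using that num_alt_1_Suc[of s 0] by (auto simp: num_alt_0 less_2_cases_iff)
  have card: "num_alt 1 s n = card {p \<in> permutations_of_set {1..n}. alternating s p \<and> contains_132_once p}" for s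
    using card_alt_perms[of "{1..n}" 1 s]
    by (simp add: alt_perms_def contains_132_once_def card_occurrences_132)
  have *: "card {p \<in> {p \<in> permutations_of_set {1..n}. n \<ge> 2 \<and> P \<and> alternating s p}. contains_132_once p} =
      (if P then num_alt 1 s n else 0)" for P s
  proof (cases "n < 2")
    case False
    then have "{p \<in> {p \<in> permutations_of_set {1..n}. n \<ge> 2 \<and> P \<and> alternating s p}. contains_132_once p} =
        (if P then {p \<in> permutations_of_set {1..n}. alternating s p \<and> contains_132_once p} else {})"
      by auto
    then show ?thesis unfolding card by simp
  qed (use small[of s] in simp)
  have up: "alternating_up = alternating True" and down: "alternating_down = alternating False"
    by (auto simp: alternating_iff)
  show "count_132_once up_down_perms n = (if odd n then num_alt 1 True n else 0)"
    "count_132_once up_up_perms n = (if even n then num_alt 1 True n else 0)"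
    "count_132_once down_up_perms n = (if odd n then num_alt 1 False n else 0)"
    "count_132_once down_down_perms n = (if even n then num_alt 1 False n else 0)"
    unfolding count_132_once_def up_down_perms_def up_up_perms_def down_up_perms_def
      down_down_perms_def up down by (rule *)+
qed

subsection \<open>Generating functions\<close>

text \<open>\<open>e\<close> selects the even or the odd lengths. With this grading, the parity
  condition on \<open>i\<close> in the recurrences turns into plain products.\<close>

definition alt_gf :: "nat \<Rightarrow> bool \<Rightarrow> bool \<Rightarrow> real fps" where
  "alt_gf c s e = Abs_fps (\<lambda>n. if even n = e then real (num_alt c s n) else 0)"

lemma alt_gf_nth: "alt_gf c s e $ n = (if even n = e then real (num_alt c s n) else 0)"
  by (simp add: alt_gf_def)

text \<open>The left factor carries the lengths with \<open>even i \<noteq> s\<close>; the parity of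
  the right factor is chosen such that both parts together with the maximum have parity
  \<open>e\<close>.\<close>

lemma alt_gf_mult_nth:
  "(alt_gf a s (\<not> s) * alt_gf b True (e = s)) $ n =
    (if even n \<noteq> e then \<Sum>i\<le>n. if even i \<noteq> s then real (num_alt a s i * num_alt b True (n - i)) else 0 else 0)"
proof -
  have "(alt_gf a s (\<not> s) * alt_gf b True (e = s)) $ n =
      (\<Sum>i\<le>n. if even n \<noteq> e then if even i \<noteq> s then real (num_alt a s i * num_alt b True (n - i)) else 0 else 0)"
    unfolding fps_mult_nth atLeast0AtMost
    by (intro sum.cong) (auto simp: alt_gf_nth)
  then show ?thesis by simp
qed

text \<open>The initial terms are the permutations of lengths 0 and 1. If \<open>s\<close> is
  \<open>False\<close>, the latter already comes from the product with two empty parts, so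
  \<open>fps_X\<close> is added only if \<open>s\<close> holds.\<close>

lemma alt_gf_0_eq:
  "alt_gf 0 s e = (if e then 1 else 0) + (if s \<and> \<not> e then fps_X else 0) +
     fps_X * (alt_gf 0 s (\<not> s) * alt_gf 0 True (e = s))"
proof (rule fps_ext)
  fix n
  show "alt_gf 0 s e $ n = ((if e then 1 else 0) + (if s \<and> \<not> e then fps_X else 0) +
     fps_X * (alt_gf 0 s (\<not> s) * alt_gf 0 True (e = s))) $ n"
  proof (cases n)
    case 0
    then show ?thesis by (simp add: alt_gf_nth num_alt_0)
  next
    case (Suc m)
    have "num_alt 0 s (Suc m) = (if m = 0 \<and> s then 1 else 0) +
       (\<Sum>i\<le>m. if even i \<noteq> s then num_alt 0 s i * num_alt 0 True (m - i) else 0)"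
      by (cases "m = 0") (auto simp: num_alt_0_Suc num_alt_0)
    then show ?thesis
      unfolding Suc by (auto simp: alt_gf_nth alt_gf_mult_nth fps_X_nth of_nat_sum if_distrib[of real]
          intro!: sum.cong)
  qed
qed

text \<open>The last term stems from the exceptional pairs: \<open>fps_X ^ 2\<close> accounts for
  the maximum and for the entry before it, and subtracting 1 removes the empty right part.\<close>

lemma alt_gf_1_eq:
  "alt_gf 1 s e = fps_X * (alt_gf 1 s (\<not> s) * alt_gf 0 True (e = s)) +
     fps_X * (alt_gf 0 s (\<not> s) * alt_gf 1 True (e = s)) +
     fps_X ^ 2 * (alt_gf 0 s s * (alt_gf 0 True (e = s) - (if e = s then 1 else 0)))"
proof (rule fps_ext)
  fix n
  let ?A = "alt_gf 1 s (\<not> s) * alt_gf 0 True (e = s)"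
  let ?B = "alt_gf 0 s (\<not> s) * alt_gf 1 True (e = s)"
  let ?C = "alt_gf 0 s s * (alt_gf 0 True (e = s) - (if e = s then 1 else 0))"
  let ?t = "\<lambda>m i. if even i \<noteq> s \<and> 0 < i \<and> i < m then num_alt 0 s (i - 1) * num_alt 0 True (m - i) else 0"
  \<comment> \<open>The exceptional sum is a convolution after the shift from \<open>i\<close> to
    \<open>Suc i\<close>; its term at \<open>i = 0\<close> is 0.\<close>
  have C: "(fps_X * ?C) $ m = (if even m \<noteq> e then real (\<Sum>i\<le>m. ?t m i) else 0)" for m
  proof (cases m)
    case (Suc k)
    define D where "D = alt_gf 0 True (e = s) - (if e = s then 1 else 0)"
    have nth: "D $ j = (if even j = (e = s) \<and> 0 < j then real (num_alt 0 True j) else 0)" for j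
      by (auto simp: alt_gf_nth num_alt_0 D_def)
    have "(fps_X * (alt_gf 0 s s * D)) $ m = (\<Sum>i\<le>k. alt_gf 0 s s $ i * D $ (k - i))"
      unfolding Suc fps_X_mult_nth by (simp add: fps_mult_nth[of "alt_gf 0 s s"] atLeast0AtMost)
    also have "\<dots> = (\<Sum>i\<le>k. if even m \<noteq> e then real (?t m (Suc i)) else 0)"
      unfolding nth alt_gf_nth Suc by (intro sum.cong refl) auto
    finally have "(fps_X * ?C) $ m = (\<Sum>i\<le>k. if even m \<noteq> e then real (?t m (Suc i)) else 0)"
      unfolding D_def .
    also have "\<dots> = (if even m \<noteq> e then real (\<Sum>i\<le>m. ?t m i) else 0)"
      unfolding Suc sum.atMost_Suc_shift by simp
    finally show ?thesis .
  qed simp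
  show "alt_gf 1 s e $ n = (fps_X * ?A + fps_X * ?B + fps_X ^ 2 * ?C) $ n"
  proof (cases n)
    case 0
    then show ?thesis by (simp add: alt_gf_nth num_alt_0)
  next
    case (Suc m)
    have "num_alt 1 s (Suc m) =
       (\<Sum>i\<le>m. if even i \<noteq> s then num_alt 1 s i * num_alt 0 True (m - i) else 0) +
       (\<Sum>i\<le>m. if even i \<noteq> s then num_alt 0 s i * num_alt 1 True (m - i) else 0) + (\<Sum>i\<le>m. ?t m i)"
      unfolding num_alt_1_Suc sum.distrib[symmetric]
      by (intro sum.cong) (auto simp: num_alt_0)
    then have *: "alt_gf 1 s e $ Suc m = ?A $ m + ?B $ m + (fps_X * ?C) $ m"
      unfolding C alt_gf_mult_nth
      by (simp add: alt_gf_nth of_nat_sum if_distrib[of real] cong: if_cong)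
    have X2: "(fps_X ^ 2 * ?C) = fps_X * (fps_X * ?C)"
      by (simp only: power2_eq_square mult.assoc)
    have shift: "(fps_X * f) $ Suc m = f $ m" for f :: "real fps"
      by simp
    show ?thesis
      unfolding Suc X2 fps_add_nth shift by (rule *)
  qed
qed

section \<open>The square root and the central binomial series\<close>

definition sqrt_fps :: "real fps" where
  "sqrt_fps = fps_radical root 2 (1 - 4 * fps_X ^ 2)"

lemma sqrt_fps_square: "sqrt_fps ^ 2 = 1 - 4 * fps_X ^ 2"
proof -
  have "fps_to_fls (sqrt_fps ^ 2) = fps_to_fls (1 - 4 * fps_X ^ 2)"
    using sqrt_1_4x2_square
    by (simp add: sqrt_1_4x2_def sqrt_fps_def fps_to_fls_power fls_times_fps_to_fls)
  then show ?thesis by (simp only: fps_to_fls_eq_iff)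
qed

lemma sqrt_fps_nth_0: "sqrt_fps $ 0 = 1"
  using sqrt_1_4x2_nth_0 by (simp add: sqrt_1_4x2_def sqrt_fps_def)

text \<open>A square root is unique up to sign, and the constant term decides the sign.\<close>

lemma fps_eq_if_square_eq:
  fixes f g :: "real fps"
  assumes "f ^ 2 = g ^ 2" "f $ 0 = 1" "g $ 0 = 1"
  shows "f = g"
proof -
  have "f \<noteq> - g" using assms(2,3) by (metis fps_neg_nth one_neq_neg_one)
  then show ?thesis using assms(1) by (simp add: power2_eq_iff)
qed

definition central_binomial_fps :: "real fps" where
  "central_binomial_fps = Abs_fps (\<lambda>n. if even n then real (n choose (n div 2)) else 0)"

lemma central_binomial_fps_nth:
  "central_binomial_fps $ n = (if even n then real (n choose (n div 2)) else 0)"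
  by (simp add: central_binomial_fps_def)

lemma central_binomial_Suc:
  "Suc m * (2 * Suc m choose Suc m) = 2 * (2 * m + 1) * (2 * m choose m)"
proof -
  have "Suc m * (2 * Suc m choose Suc m) = 2 * Suc m * (2 * m + 1 choose m)"
    using Suc_times_binomial_eq[of "2 * m + 1" m] by simp
  also have "2 * m + 1 choose m = (2 * m + 1 choose Suc m)"
    using binomial_symmetric[of m "2 * m + 1"] by simp
  also have "2 * Suc m * (2 * m + 1 choose Suc m) = 2 * (Suc m * (Suc (2 * m) choose Suc m))"
    by (simp only: mult.assoc Suc_eq_plus1)
  also have "\<dots> = 2 * (2 * m + 1) * (2 * m choose m)"
    using Suc_times_binomial[of m "2 * m"] by (simp only: mult.assoc Suc_eq_plus1)
  finally show ?thesis .
qed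

lemma sqrt_fps_central_binomial: "sqrt_fps * central_binomial_fps = 1"
proof -
  let ?B = central_binomial_fps
  let ?a = "1 - 4 * fps_X ^ 2 :: real fps"
  \<comment> \<open>\<open>?B\<close> solves the differential equation of \<open>(1 - 4 * x^2) powr (-1/2)\<close>.\<close>
  have ode: "fps_deriv ?B * ?a = 4 * fps_X * ?B"
  proof (rule fps_ext)
    fix n
    have s: "fps_deriv ?B * ?a = fps_deriv ?B - fps_const 4 * (fps_X * (fps_X * fps_deriv ?B))"
      and t: "4 * fps_X * ?B = fps_const 4 * (fps_X * ?B)"
      by (simp_all add: algebra_simps power2_eq_square numeral_fps_const)
    show "(fps_deriv ?B * ?a) $ n = (4 * fps_X * ?B) $ n"
    proof (cases "even n")
      case True
      then show ?thesis unfolding s t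
        by (cases n; cases "n - 1") (auto simp: central_binomial_fps_nth)
    next
      case False
      then obtain m where n: "n = 2 * m + 1" by (auto elim: oddE)
      have "real (Suc m) * real (2 * Suc m choose Suc m) = 2 * (2 * real m + 1) * real (2 * m choose m)"
        using central_binomial_Suc[of m, THEN arg_cong[where f = real]]
        by (simp only: of_nat_mult of_nat_add of_nat_numeral of_nat_1)
      then have 1: "fps_deriv ?B $ n = 4 * (2 * real m + 1) * real (2 * m choose m)"
        unfolding n by (simp add: central_binomial_fps_nth algebra_simps)
      have 2: "(fps_X * (fps_X * fps_deriv ?B)) $ n = 2 * real m * real (2 * m choose m)"
        unfolding n by (cases m) (simp_all add: central_binomial_fps_nth)
      have 3: "(fps_X * ?B) $ n = real (2 * m choose m)"
        unfolding n by (simp add: central_binomial_fps_nth)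
      show ?thesis unfolding s t fps_sub_nth fps_mult_left_const_nth 1 2 3
        by (simp add: algebra_simps)
    qed
  qed
  \<comment> \<open>By the differential equation this product has derivative 0, so it equals its
    constant term 1.\<close>
  have "fps_deriv (?B ^ 2 * ?a) = 2 * ?B * (fps_deriv ?B * ?a) - 8 * fps_X * ?B ^ 2"
    by (simp add: power2_eq_square algebra_simps)
  also have "\<dots> = 0" unfolding ode by (simp add: power2_eq_square algebra_simps)
  finally have "?B ^ 2 * ?a = fps_const ((?B ^ 2 * ?a) $ 0)"
    by (simp only: fps_deriv_eq_0_iff)
  also have "(?B ^ 2 * ?a) $ 0 = 1"
    by (simp add: central_binomial_fps_nth numeral_fps_const power2_eq_square)
  finally have "?B ^ 2 * ?a = 1" by simp
  then have "(sqrt_fps * ?B) ^ 2 = 1 ^ 2"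
    by (simp add: power_mult_distrib sqrt_fps_square mult.commute)
  then show ?thesis
    by (rule fps_eq_if_square_eq) (simp_all add: sqrt_fps_nth_0 central_binomial_fps_nth)
qed

section \<open>Solving the equations for the generating functions\<close>

lemma alt_gf_0_solution:
  "sqrt_fps = 1 - 2 * fps_X * alt_gf 0 True False"
  "alt_gf 0 True False = fps_X + fps_X * alt_gf 0 True False ^ 2"
  "alt_gf 0 True False = fps_X * alt_gf 0 True True"
  "alt_gf 0 True True = 1 + fps_X * (alt_gf 0 True False * alt_gf 0 True True)"
  "alt_gf 0 False True = alt_gf 0 True True"
  "alt_gf 0 False False = fps_X * alt_gf 0 True True ^ 2"
proof -
  let ?U = "alt_gf 0 True False" and ?E = "alt_gf 0 True True"
  let ?F = "alt_gf 0 False True" and ?D = "alt_gf 0 False False"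
  have U: "?U = fps_X + fps_X * (?U * ?U)" and E: "?E = 1 + fps_X * (?U * ?E)"
    and F: "?F = 1 + fps_X * (?F * ?U)" and D: "?D = fps_X * (?F * ?E)"
    using alt_gf_0_eq[of True False] alt_gf_0_eq[of True True]
      alt_gf_0_eq[of False True] alt_gf_0_eq[of False False] by simp_all
  \<comment> \<open>This completes the square in the quadratic equation \<open>U\<close>.\<close>
  have "sqrt_fps ^ 2 = (1 - 2 * fps_X * ?U) ^ 2"
    unfolding sqrt_fps_square using U by algebra
  then show "sqrt_fps = 1 - 2 * fps_X * ?U"
    by (rule fps_eq_if_square_eq) (simp_all add: sqrt_fps_nth_0 mult.assoc)
  \<comment> \<open>\<open>E\<close> says that \<open>?E\<close> is the inverse of
    \<open>1 - fps_X * ?U\<close>, and \<open>U\<close> that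
    \<open>?U * (1 - fps_X * ?U) = fps_X\<close>.\<close>
  show "?U = fps_X * ?E" using U E by algebra
  show "?U = fps_X + fps_X * ?U ^ 2" using U by algebra
  show "?E = 1 + fps_X * (?U * ?E)" by (rule E)
  show FE: "?F = ?E" using E F by algebra
  show "?D = fps_X * ?E ^ 2" using D FE by algebra
qed

text \<open>The equations are linear in the unknown series. The coefficient of \<open>?V\<close> is
  \<open>1 - 2 * fps_X * ?U\<close>, which is \<open>sqrt_fps\<close>; that of \<open>?G\<close> and
  \<open>?H\<close> is \<open>1 - fps_X * ?U\<close>, with inverse \<open>?E\<close>; and
  \<open>?K\<close> is explicit. Denominators are multiplied out to stay within power
  series.\<close>

lemma alt_gf_1_solution:
  "2 * fps_X * sqrt_fps * alt_gf 1 True False = 1 - 2 * fps_X ^ 2 - sqrt_fps"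
  "fps_X ^ 2 * sqrt_fps * alt_gf 1 True True = (fps_X ^ 2 - 1) * sqrt_fps + (1 - 3 * fps_X ^ 2)"
  "alt_gf 1 False True = alt_gf 1 True True"
  "2 * fps_X ^ 3 * sqrt_fps * alt_gf 1 False False =
     (2 * fps_X ^ 4 + 4 * fps_X ^ 2 - 3) * sqrt_fps + (3 - 10 * fps_X ^ 2)"
proof -
  let ?U = "alt_gf 0 True False" and ?E = "alt_gf 0 True True"
  let ?F = "alt_gf 0 False True" and ?D = "alt_gf 0 False False"
  let ?V = "alt_gf 1 True False" and ?G = "alt_gf 1 True True"
  let ?H = "alt_gf 1 False True" and ?K = "alt_gf 1 False False"
  let ?X = "fps_X :: real fps"
  note sol = alt_gf_0_solution
  have V: "?V = ?X * (?V * ?U) + ?X * (?U * ?V) + ?X ^ 2 * (?E * ?U)"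
    and G: "?G = ?X * (?V * ?E) + ?X * (?U * ?G) + ?X ^ 2 * (?E * (?E - 1))"
    and H: "?H = ?X * (?H * ?U) + ?X * (?E * ?V) + ?X ^ 2 * (?D * ?U)"
    and K: "?K = ?X * (?H * ?E) + ?X * (?E * ?G) + ?X ^ 2 * (?D * (?E - 1))"
    using alt_gf_1_eq[of True False] alt_gf_1_eq[of True True]
      alt_gf_1_eq[of False True] alt_gf_1_eq[of False False] by (simp_all add: sol(5) del: One_nat_def)
  have sV: "sqrt_fps * ?V = ?X * ?U ^ 2"
    using V sol(1,3) by algebra
  show 1: "2 * ?X * sqrt_fps * ?V = 1 - 2 * ?X ^ 2 - sqrt_fps"
    using sV sol(1,2) by algebra
  have "?X ^ 2 * ?G = ?U ^ 2 * (?X * ?V + ?X * ?U - ?X ^ 2)"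
    using G sol(3,4) by algebra
  then have XG: "?X ^ 2 * sqrt_fps * ?G = ?U ^ 2 * (?X * (?X * ?U ^ 2) + sqrt_fps * (?X * ?U - ?X ^ 2))"
    using sV by algebra
  then show 2: "?X ^ 2 * sqrt_fps * ?G = (?X ^ 2 - 1) * sqrt_fps + (1 - 3 * ?X ^ 2)"
    using sol(1,2) by algebra
  have "?H = ?E * (?X * (?E * ?V) + ?X ^ 2 * (?D * ?U))" using H sol(4) by algebra
  moreover have "?G = ?E * (?X * (?V * ?E) + ?X ^ 2 * (?E * (?E - 1)))" using G sol(4) by algebra
  \<comment> \<open>The two right-hand sides agree because \<open>?D = fps_X * ?E ^ 2\<close> and
    \<open>?E - 1 = fps_X * ?U * ?E\<close>. Hence up-up and down-down have equal counts.\<close>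
  ultimately show HG: "?H = ?G" using sol(3,4,6) by algebra
  have "2 * ?X ^ 3 * ?K = 4 * ?X * ?U * (?X ^ 2 * ?G) + 2 * ?X ^ 3 * ?U ^ 2 * (?U - ?X)"
    using K sol(3,6) unfolding HG by algebra
  then have "2 * ?X ^ 3 * sqrt_fps * ?K =
      4 * ?X * ?U * (?X ^ 2 * sqrt_fps * ?G) + 2 * sqrt_fps * ?X ^ 3 * ?U ^ 2 * (?U - ?X)"
    by algebra
  then show "2 * ?X ^ 3 * sqrt_fps * ?K =
     (2 * ?X ^ 4 + 4 * ?X ^ 2 - 3) * sqrt_fps + (3 - 10 * ?X ^ 2)"
    unfolding 2 using sol(1,2) by algebra
qed

text \<open>Multiplication by the inverse of \<open>sqrt_fps\<close> gives a form whose coefficients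
  can be read off.\<close>

lemma alt_gf_1_central_binomial:
  "2 * fps_X * alt_gf 1 True False = (1 - 2 * fps_X ^ 2) * central_binomial_fps - 1"
  "fps_X ^ 2 * alt_gf 1 True True = fps_X ^ 2 - 1 + (1 - 3 * fps_X ^ 2) * central_binomial_fps"
  "2 * fps_X ^ 3 * alt_gf 1 False False =
     2 * fps_X ^ 4 + 4 * fps_X ^ 2 - 3 + (3 - 10 * fps_X ^ 2) * central_binomial_fps"
  using alt_gf_1_solution(1,2,4) sqrt_fps_central_binomial by algebra+

subsection \<open>Coefficients and closed forms\<close>

lemma binom0_of_nat: "binom0 (int a) (real b) = a choose b"
  by (auto simp: binom0_def binomial_eq_0_iff)

lemma binom0_eq_0: "b < 0 \<or> b \<notin> \<int> \<Longrightarrow> binom0 a b = 0"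
  by (auto simp: binom0_def)

lemma half_odd_notin_Ints: "odd k \<Longrightarrow> real_of_int k / 2 \<notin> \<int>"
proof
  assume "odd k" "real_of_int k / 2 \<in> \<int>"
  then obtain j where "real_of_int k / 2 = of_int j" by (auto elim: Ints_cases)
  then have "real_of_int k = of_int (2 * j)" by simp
  then have "k = 2 * j" by (simp only: of_int_eq_iff)
  then show False using \<open>odd k\<close> by simp
qed

text \<open>Pascal's rule is applied twice; the two outer terms agree by symmetry. The case
  distinction is needed because \<open>m - 1\<close> is 0 for \<open>m = 0\<close>.\<close>

lemma central_binomial_Pascal:
  "2 * Suc m choose Suc m = 2 * (2 * m choose m) + 2 * (if m = 0 then 0 else 2 * m choose (m - 1))"
proof (cases m)
  case (Suc k)
  have "2 * Suc k choose k = 2 * Suc k choose Suc (Suc k)"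
    using binomial_symmetric[of k "2 * Suc k"] by simp
  then show ?thesis unfolding Suc by simp
qed simp

lemma count_up_down: "count_132_once up_down_perms n = binom0 (int n - 1) ((real n - 3) / 2)"
proof (cases "even n")
  case True
  then have "real_of_int (int n - 3) / 2 \<notin> \<int>" by (intro half_odd_notin_Ints) simp
  with True show ?thesis by (simp add: count_132_once_eq binom0_eq_0)
next
  case False
  then obtain m where n: "n = Suc (2 * m)" by (auto elim: oddE)
  \<comment> \<open>The factor \<open>fps_X\<close> shifts the coefficient at \<open>n\<close> to
    \<open>Suc n\<close>.\<close>
  have "(2 * fps_X * alt_gf 1 True False) $ Suc n =
      central_binomial_fps $ Suc n - 2 * central_binomial_fps $ (n - 1)"
    unfolding alt_gf_1_central_binomial n
    by (simp add: algebra_simps numeral_fps_const power2_eq_square)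
  then have "2 * real (num_alt 1 True n) = real (2 * Suc m choose Suc m) - 2 * real (2 * m choose m)"
    unfolding n by (simp add: alt_gf_nth central_binomial_fps_nth numeral_fps_const mult.assoc
        del: One_nat_def binomial_Suc_Suc)
  then have "num_alt 1 True n = (if m = 0 then 0 else 2 * m choose (m - 1))"
    unfolding central_binomial_Pascal by (simp del: One_nat_def split: if_splits)
  moreover have "binom0 (int n - 1) ((real n - 3) / 2) = (if m = 0 then 0 else 2 * m choose (m - 1))"
  proof (cases m)
    case (Suc k)
    have "int n - 1 = int (2 * m)" "(real n - 3) / 2 = real k" unfolding n Suc by (simp_all add: field_simps)
    then show ?thesis using binom0_of_nat[of "2 * m" k] Suc by (simp only:) simp
  qed (simp add: n binom0_eq_0)
  ultimately show ?thesis using False by (simp add: count_132_once_eq)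
qed

lemma num_alt_1_True_even:
  "even n \<Longrightarrow> num_alt 1 True n = 2 * binom0 (int n - 1) ((real n - 4) / 2)"
proof -
  assume "even n"
  then obtain m where n: "n = 2 * m" by (auto elim: evenE)
  show ?thesis
  proof (cases m)
    case 0
    then show ?thesis by (simp add: n num_alt_0 binom0_eq_0)
  next
    case (Suc k)
    \<comment> \<open>As \<open>m > 0\<close>, the index \<open>n + 2\<close> is at least 4, beyond
      the polynomial \<open>fps_X ^ 2 - 1\<close>.\<close>
    have "(fps_X ^ 2 * alt_gf 1 True True) $ (n + 2) =
        central_binomial_fps $ (n + 2) - 3 * central_binomial_fps $ n"
      unfolding alt_gf_1_central_binomial n Suc
      by (simp add: algebra_simps numeral_fps_const power2_eq_square)
    then have *: "real (num_alt 1 True n) = real (2 * Suc m choose Suc m) - 3 * real (2 * m choose m)"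
      unfolding n by (simp add: alt_gf_nth central_binomial_fps_nth power2_eq_square mult.assoc
          del: One_nat_def binomial_Suc_Suc)
    \<comment> \<open>By \<open>central_binomial_Pascal\<close> the count is
      \<open>2 * (2 * m choose (m - 1)) - (2 * m choose m)\<close>. Writing both terms in row
      \<open>2 * k + 1\<close> makes \<open>2 * k + 1 choose k\<close> cancel.\<close>
    have 1: "2 * m choose m = 2 * (2 * k + 1 choose k)"
      using binomial_symmetric[of k "2 * k + 1"] unfolding Suc by simp
    have 2: "2 * m choose (m - 1) = (2 * k + 1 choose k) + (if k = 0 then 0 else 2 * k + 1 choose (k - 1))"
      unfolding Suc by (cases k) simp_all
    have "num_alt 1 True n = 2 * (if k = 0 then 0 else 2 * k + 1 choose (k - 1))"
      using * unfolding central_binomial_Pascal unfolding 1 2 using Suc by (simp del: One_nat_def split: if_splits)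
    moreover have "binom0 (int n - 1) ((real n - 4) / 2) = (if k = 0 then 0 else 2 * k + 1 choose (k - 1))"
    proof (cases k)
      case (Suc l)
      have "int n - 1 = int (2 * k + 1)" "(real n - 4) / 2 = real l"
        unfolding n \<open>m = Suc k\<close> Suc by (simp_all add: field_simps)
      then show ?thesis using binom0_of_nat[of "2 * k + 1" l] Suc by (simp only:) simp
    qed (simp add: n Suc binom0_eq_0)
    ultimately show ?thesis by simp
  qed
qed

lemma num_alt_1_False_even: "even n \<Longrightarrow> num_alt 1 False n = num_alt 1 True n"
  using arg_cong[OF alt_gf_1_solution(3), of "\<lambda>f. f $ n"] by (simp add: alt_gf_nth)

lemma count_up_up_and_down_down:
  "count_132_once up_up_perms n = 2 * binom0 (int n - 1) ((real n - 4) / 2)"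
  "count_132_once down_down_perms n = 2 * binom0 (int n - 1) ((real n - 4) / 2)"
proof -
  have "binom0 (int n - 1) ((real n - 4) / 2) = 0" if "odd n"
  proof -
    have "real_of_int (int n - 4) / 2 \<notin> \<int>" using that by (intro half_odd_notin_Ints) simp
    then show ?thesis by (simp add: binom0_eq_0)
  qed
  then show "count_132_once up_up_perms n = 2 * binom0 (int n - 1) ((real n - 4) / 2)"
    "count_132_once down_down_perms n = 2 * binom0 (int n - 1) ((real n - 4) / 2)"
    using num_alt_1_True_even[of n] num_alt_1_False_even[of n]
    by (simp_all add: count_132_once_eq del: One_nat_def)
qed

lemma count_down_up:
  assumes "n \<ge> 2"
  shows "real (count_132_once down_up_perms n) =
    3 / 2 * real (binom0 (int n + 3) ((real n + 3) / 2)) - 5 * real (binom0 (int n + 1) ((real n + 1) / 2))"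
proof (cases "even n")
  case True
  then have "real_of_int (int n + 3) / 2 \<notin> \<int>" "real_of_int (int n + 1) / 2 \<notin> \<int>"
    by (intro half_odd_notin_Ints; simp)+
  with True show ?thesis by (simp add: count_132_once_eq binom0_eq_0)
next
  case False
  then obtain k where n: "n = Suc (2 * Suc k)" using assms
    by (metis oddE Suc_eq_plus1 not0_implies_Suc mult_0_right add_0 numeral_le_one_iff
        semiring_norm(69))
  \<comment> \<open>Since \<open>n\<close> is odd and at least 3, the index is at least 6, beyond
    the degree 4 of the polynomial part.\<close>
  have "(2 * fps_X ^ 3 * alt_gf 1 False False) $ Suc (Suc (Suc n)) =
      3 * central_binomial_fps $ Suc (Suc (Suc n)) - 10 * central_binomial_fps $ Suc n"
    unfolding alt_gf_1_central_binomial n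
    by (simp add: left_diff_distrib numeral_fps_const power2_eq_square power4_eq_xxxx mult.assoc)
  then have "2 * real (num_alt 1 False n) =
      3 * real (Suc (Suc (Suc n)) choose Suc (Suc (n div 2))) - 10 * real (Suc n choose Suc (n div 2))"
    using False by (simp add: alt_gf_nth central_binomial_fps_nth power3_eq_cube mult.assoc numeral_fps_const
        numeral_3_eq_3 del: One_nat_def binomial_Suc_Suc)
  moreover have "(real n + 3) / 2 = real (Suc (Suc (n div 2)))" "(real n + 1) / 2 = real (Suc (n div 2))"
    using False by (auto elim!: oddE)
  moreover have "int n + 3 = int (Suc (Suc (Suc n)))" "int n + 1 = int (Suc n)" by simp_all
  ultimately show ?thesis
    using False by (simp only: binom0_of_nat count_132_once_eq if_True not_False_eq_True)
qed

section \<open>Closed forms as Laurent series\<close>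

lemma gen_fun_count_eq:
  "gen_fun (count_132_once up_down_perms) = fps_to_fls (alt_gf 1 True False)"
  "gen_fun (count_132_once up_up_perms) = fps_to_fls (alt_gf 1 True True)"
  "gen_fun (count_132_once down_up_perms) = fps_to_fls (alt_gf 1 False False)"
  "gen_fun (count_132_once down_down_perms) = fps_to_fls (alt_gf 1 True True)"
proof -
  have "gen_fun (count_132_once down_down_perms) = fps_to_fls (alt_gf 1 False True)"
    by (auto simp: gen_fun_def alt_gf_def count_132_once_eq
        intro!: arg_cong[where f = fps_to_fls] arg_cong[where f = Abs_fps])
  then show "gen_fun (count_132_once down_down_perms) = fps_to_fls (alt_gf 1 True True)"
    by (simp only: alt_gf_1_solution(3))
qed (auto simp: gen_fun_def alt_gf_def count_132_once_eq
    intro!: arg_cong[where f = fps_to_fls] arg_cong[where f = Abs_fps])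

lemma gen_fun_closed_forms:
  "gen_fun (count_132_once up_down_perms) =
     fls_X * (1 - sqrt_1_4x2) / (1 - 4 * fls_X ^ 2 + sqrt_1_4x2)" (is ?th1)
  "gen_fun (count_132_once up_up_perms) =
     (fls_X ^ 2 - 1) / fls_X ^ 2 + (1 - 3 * fls_X ^ 2) / (fls_X ^ 2 * sqrt_1_4x2)" (is ?th2)
  "gen_fun (count_132_once down_up_perms) =
     (2 * fls_X ^ 4 + 4 * fls_X ^ 2 - 3) / (2 * fls_X ^ 3) +
     (3 - 10 * fls_X ^ 2) / (2 * fls_X ^ 3 * sqrt_1_4x2)" (is ?th3)
proof -
  let ?X = "fls_X :: real fls" and ?s = sqrt_1_4x2
  have s: "fps_to_fls sqrt_fps = ?s" by (simp add: sqrt_fps_def sqrt_1_4x2_def)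
  have s0: "?s \<noteq> 0" using sqrt_1_4x2_nth_0 by auto
  \<comment> \<open>The first denominator factors as \<open>?s * (?s + 1)\<close>, so both factors
    must be nonzero.\<close>
  have "fls_nth (?s + 1) 0 = 2" by (simp add: sqrt_1_4x2_nth_0)
  then have s1: "?s + 1 \<noteq> 0" by (metis fls_zero_nth zero_neq_numeral)
  have X0: "?X \<noteq> 0" by simp
  note sol = alt_gf_1_solution[THEN arg_cong[where f = fps_to_fls]]
  define f where "f = fps_to_fls (alt_gf 1 True False)"
  define g where "g = fps_to_fls (alt_gf 1 True True)"
  define h where "h = fps_to_fls (alt_gf 1 False False)"
  have f: "2 * ?X * ?s * f = 1 - 2 * ?X ^ 2 - ?s"
    using sol(1) by (simp add: f_def fls_times_fps_to_fls fps_to_fls_power s del: One_nat_def)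
  have g: "?X ^ 2 * ?s * g = (?X ^ 2 - 1) * ?s + (1 - 3 * ?X ^ 2)"
    using sol(2) by (simp add: g_def fls_times_fps_to_fls fps_to_fls_power s del: One_nat_def)
  have h: "2 * ?X ^ 3 * ?s * h = (2 * ?X ^ 4 + 4 * ?X ^ 2 - 3) * ?s + (3 - 10 * ?X ^ 2)"
    using sol(4) by (simp add: h_def fls_times_fps_to_fls fps_to_fls_power s del: One_nat_def)
  \<comment> \<open>Multiplying \<open>f\<close> by \<open>?s + 1\<close> and replacing
    \<open>?s ^ 2\<close> turns the right-hand side into
    \<open>2 * ?X ^ 2 * (1 - ?s)\<close>.\<close>
  have "2 * ?X * (?s * (?s + 1) * f) = 2 * ?X * (?X * (1 - ?s))"
    using f sqrt_1_4x2_square by algebra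
  then have "?s * (?s + 1) * f = ?X * (1 - ?s)"
    using X0 by simp
  moreover have "1 - 4 * ?X ^ 2 + ?s = ?s * (?s + 1)"
    using sqrt_1_4x2_square by algebra
  ultimately show ?th1
    using s0 s1 unfolding gen_fun_count_eq f_def[symmetric]
    by (simp add: nonzero_eq_divide_eq mult.commute)
  have solve: "y = p / a + q / (a * b)" if "a * b * y = p * b + q" "a \<noteq> 0" "b \<noteq> 0" for a b p q y :: "real fls"
  proof -
    have "y = (p * b + q) / (a * b)"
      using that by (metis mult_eq_0_iff nonzero_mult_div_cancel_left)
    then show ?thesis using that(2,3) by (simp add: add_divide_distrib)
  qed
  show ?th2
    unfolding gen_fun_count_eq g_def[symmetric] using X0 s0 by (intro solve[OF g]) auto
  show ?th3
    unfolding gen_fun_count_eq h_def[symmetric] using X0 s0 by (intro solve[OF h]) auto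
qed

theorem theorem4p2:
  shows
    "(gen_fun (count_132_once up_down_perms) =
        fls_X * (1 - sqrt_1_4x2) / (1 - 4 * fls_X ^ 2 + sqrt_1_4x2)
      \<and> (\<forall>n. count_132_once up_down_perms n = binom0 (int n - 1) ((real n - 3) / 2)))
     \<and>
     (gen_fun (count_132_once up_up_perms) =
        (fls_X ^ 2 - 1) / fls_X ^ 2 + (1 - 3 * fls_X ^ 2) / (fls_X ^ 2 * sqrt_1_4x2)
      \<and> (\<forall>n. count_132_once up_up_perms n = 2 * binom0 (int n - 1) ((real n - 4) / 2)))
     \<and>
     (gen_fun (count_132_once down_down_perms) =
        (fls_X ^ 2 - 1) / fls_X ^ 2 + (1 - 3 * fls_X ^ 2) / (fls_X ^ 2 * sqrt_1_4x2)
      \<and> (\<forall>n. count_132_once down_down_perms n = 2 * binom0 (int n - 1) ((real n - 4) / 2)))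
     \<and>
     (gen_fun (count_132_once down_up_perms) =
        (2 * fls_X ^ 4 + 4 * fls_X ^ 2 - 3) / (2 * fls_X ^ 3) +
        (3 - 10 * fls_X ^ 2) / (2 * fls_X ^ 3 * sqrt_1_4x2)
      \<and> (\<forall>n\<ge>2. real (count_132_once down_up_perms n) =
            3 / 2 * real (binom0 (int n + 3) ((real n + 3) / 2)) -
            5 * real (binom0 (int n + 1) ((real n + 1) / 2))))"
  using gen_fun_closed_forms gen_fun_count_eq(2,4) count_up_down count_up_up_and_down_down count_down_up
  by simp

end
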